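(* Let $\mathsf{x}^*=\sum_{j\in\mathcal{J}}x_j^*\mathbf{e}_j\in\mathbb{R}^n$, where $\mathcal{J}=\mathrm{supp}(\mathsf{x}^* )$, and let $\mathcal{J}^c=\{1,\dots,n\}\setminus\mathcal{J}$. Suppose that the linear system $$\Big[\sum_{j\in\mathcal{J}}a_j\mathsf{W}^{-1}\mathsf{P}\mathbf{e}_j\Big]_i=\mathrm{sgn}(x_i^* )\quad\forall i\in\mathcal{J}$$ has a solution $(a_j)_{j\in\mathcal{J}}$, $a_j\in\mathbb{R}$, which satisfies $$\Big[\sum_{j\in\mathcal{J}}a_j\mathsf{W}^{-1}\mathsf{P}\mathbf{e}_j\Big]_i\in(-1,1)\quad\forall i\in\mathcal{J}^c.$$ Then, provided that $\alpha>0$ is chosen such that $$\mathrm{sgn}(x_j^*-\alpha a_j)=\mathrm{sgn}(x_j^* )\quad\forall j\in\mathcal{J},$$ the vector $$\mathbf{y}_\alpha^*=\sum_{j\in\mathcal{J}}(x_j^*-\alpha a_j)\mathbf{e}_j$$ solves $$\min_{\mathbf{x}\in\mathbb{R}^n}\left\{\frac12\|\mathsf{P}\mathbf{x}-\mathsf{P}\mathsf{x}^*\|_2^2+\alpha\|\mathsf{W}\mathbf{x}\|_1\right\}.$$ Furthermore, the solution $\mathbf{y}_\alpha^*$ of this minimization problem is unique if and only if $\mathsf{A}$ is injective on the support of $\mathsf{x}^*$.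
   Context: $\mathsf{A}\in\mathbb{R}^{m\times n}$ is a matrix with nontrivial null space $\mathcal{N}(\mathsf{A})$, $\mathsf{A}^\dagger$ is its Moore-Penrose pseudo-inverse, and $\mathsf{P}=\mathsf{A}^\dagger\mathsf{A}$ is the orthogonal projection of $\mathbb{R}^n$ onto $\mathcal{N}(\mathsf{A})^\perp$. $\mathbf{e}_1,\dots,\mathbf{e}_n$ are the standard basis vectors of $\mathbb{R}^n$, and it is assumed that $\mathsf{P}\mathbf{e}_i\neq 0$ for all $i$. $\mathsf{W}\in\mathbb{R}^{n\times n}$ is the (invertible) diagonal matrix defined by $\mathsf{W}\mathbf{e}_i=\|\mathsf{P}\mathbf{e}_i\|_2\,\mathbf{e}_i$. $[\mathbf{v}]_i$ is the $i$-th component of $\mathbf{v}$; $\mathrm{supp}(\mathbf{v})=\{i: v_i\neq 0\}$. "$\mathsf{A}$ is injective on the support of $\mathsf{x}^*$" means that $\mathsf{A}$ is injective on the subspace $\{\mathbf{v}\in\mathbb{R}^n:\mathrm{supp}(\mathbf{v})\subseteq\mathrm{supp}(\mathsf{x}^* )\}$. *)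

theory Defs imports "HOL-Analysis.Analysis"
begin

text \<open>
  The Moore-Penrose pseudo-inverse of a real matrix is the unique solution of the four Penrose
  equations; existence and uniqueness are proved below, so \<open>THE\<close> is well defined.
\<close>

definition penrose_inverse :: "real ^ 'n ^ 'm \<Rightarrow> real ^ 'm ^ 'n \<Rightarrow> bool" where
  "penrose_inverse A X \<longleftrightarrow>
     A ** X ** A = A \<and> X ** A ** X = X \<and>
     transpose (A ** X) = A ** X \<and> transpose (X ** A) = X ** A"

definition pinv :: "real ^ 'n ^ 'm \<Rightarrow> real ^ 'm ^ 'n" where
  "pinv A = (THE X. penrose_inverse A X)"

lemma penrose_inverse_unique:
  assumes "penrose_inverse A X" "penrose_inverse A Y"
  shows "X = Y"
proof -
  have AXAY: "A ** X = A ** Y"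
  proof -
    have "A ** X = transpose (A ** Y ** (A ** X))"
      using assms
      by (metis matrix_mul_assoc matrix_transpose_mul penrose_inverse_def transpose_transpose)
    also have "\<dots> = transpose (A ** X) ** transpose (A ** Y)"
      by (simp only: matrix_transpose_mul)
    also have "\<dots> = A ** X ** A ** Y"
      using assms by (simp add: penrose_inverse_def matrix_mul_assoc)
    also have "\<dots> = A ** Y"
      using assms by (simp add: penrose_inverse_def)
    finally show ?thesis .
  qed
  have XAYA: "X ** A = Y ** A"
  proof -
    have "X ** A = X ** A ** (Y ** A)"
      using assms by (metis matrix_mul_assoc penrose_inverse_def)
    also have "\<dots> = transpose (X ** A) ** transpose (Y ** A)"
      using assms by (simp add: penrose_inverse_def)
    also have "\<dots> = transpose (Y ** A ** (X ** A))"
      by (simp only: matrix_transpose_mul)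
    also have "\<dots> = transpose (Y ** A)"
      using assms by (metis matrix_mul_assoc penrose_inverse_def)
    finally show ?thesis using assms by (simp add: penrose_inverse_def)
  qed
  have "X = X ** (A ** X)" using assms by (metis matrix_mul_assoc penrose_inverse_def)
  also have "\<dots> = Y ** A ** Y" by (metis AXAY XAYA matrix_mul_assoc)
  finally show ?thesis using assms by (simp add: penrose_inverse_def)
qed

lemma penrose_inverse_exists: "\<exists>X. penrose_inverse A X"
proof -
  let ?N = "{v. A *v v = 0}"
  have subN: "subspace ?N"
    by (simp add: subspace_def matrix_vector_right_distrib matrix_vector_mult_scaleR)
  have spN: "span ?N = ?N" using subN by simp
  have spR: "span (range ((*v) A)) = range ((*v) A)"
    by (simp add: linear_subspace_image span_eq_iff)
  have ex: "\<exists>u. (\<forall>v. A *v v = 0 \<longrightarrow> u \<bullet> v = 0) \<and> (\<forall>x. (y - A *v u) \<bullet> (A *v x) = 0)" for y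
  proof -
    obtain p w where p: "p \<in> span (range ((*v) A))"
      and w: "\<And>r. r \<in> span (range ((*v) A)) \<Longrightarrow> orthogonal w r" and y: "y = p + w"
      using orthogonal_subspace_decomp_exists by blast
    obtain x where x: "p = A *v x" using p spR by auto
    obtain v u where v: "v \<in> span ?N"
      and u: "\<And>r. r \<in> span ?N \<Longrightarrow> orthogonal u r" and xvu: "x = v + u"
      using orthogonal_subspace_decomp_exists by blast
    have "A *v v = 0" using v spN by blast
    then have Au: "A *v u = p" using x xvu by (simp add: matrix_vector_right_distrib)
    have "(y - A *v u) \<bullet> (A *v z) = 0" for z
      using w[of "A *v z"] y Au by (simp add: orthogonal_def span_base)
    moreover have "u \<bullet> r = 0" if "A *v r = 0" for r
      using u[of r] that by (simp add: orthogonal_def span_base)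
    ultimately show ?thesis by blast
  qed
  then obtain g where gN: "\<And>y v. A *v v = 0 \<Longrightarrow> g y \<bullet> v = 0"
    and gR: "\<And>y x. (y - A *v g y) \<bullet> (A *v x) = 0" by metis
  have uniq: "u = g y" if 1: "\<And>v. A *v v = 0 \<Longrightarrow> u \<bullet> v = 0"
    and 2: "\<And>x. (y - A *v u) \<bullet> (A *v x) = 0" for u y
  proof -
    have "(A *v (g y - u)) \<bullet> (A *v (g y - u)) = 0"
      using 2[of "g y - u"] gR[of y "g y - u"]
      by (simp add: matrix_vector_mult_diff_distrib algebra_simps)
    then have z: "A *v (g y - u) = 0" by simp
    have "(g y - u) \<bullet> (g y - u) = 0"
      using 1[OF z] gN[OF z, of y] by (simp add: inner_diff_left)
    then show ?thesis by simp
  qed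
  have "linear g"
  proof (rule linearI)
    fix x y
    show "g (x + y) = g x + g y"
    proof (rule uniq[symmetric])
      fix v assume "A *v v = 0"
      then show "(g x + g y) \<bullet> v = 0" by (simp add: gN inner_add_left)
    next
      fix z
      show "(x + y - A *v (g x + g y)) \<bullet> (A *v z) = 0"
        using gR[of x z] gR[of y z] by (simp add: matrix_vector_right_distrib algebra_simps)
    qed
  next
    fix c :: real and x
    show "g (c *\<^sub>R x) = c *\<^sub>R g x"
    proof (rule uniq[symmetric])
      fix v assume "A *v v = 0"
      then show "(c *\<^sub>R g x) \<bullet> v = 0" by (simp add: gN)
    next
      fix z
      show "(c *\<^sub>R x - A *v (c *\<^sub>R g x)) \<bullet> (A *v z) = 0"
        using gR[of x z]
        by (simp add: matrix_vector_mult_scaleR scaleR_diff_right[symmetric])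
    qed
  qed
  then have G: "matrix g *v x = g x" for x by (simp add: matrix_works)
  have AgA: "A *v g (A *v x) = A *v x" for x
  proof -
    have "(A *v x - A *v g (A *v x)) \<bullet> (A *v x - A *v g (A *v x)) = 0"
      using gR[of "A *v x" "x - g (A *v x)"] by (simp add: matrix_vector_mult_diff_distrib)
    then show ?thesis by simp
  qed
  have gAg: "g (A *v g y) = g y" for y
    by (rule uniq[symmetric]) (simp_all add: gN)
  have symI: "transpose B = B" if "\<And>x y. (B *v x) \<bullet> y = x \<bullet> (B *v y)" for B :: "real ^ 'k ^ 'k"
  proof -
    have "(transpose B *v x) \<bullet> y = (B *v x) \<bullet> y" for x y
      using that by (simp add: dot_lmul_matrix transpose_matrix_vector)
    then have "transpose B *v x = B *v x" for x using vector_eq_rdot by blast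
    then show ?thesis by (simp add: matrix_eq)
  qed
  have sR: "(A *v g x) \<bullet> y = x \<bullet> (A *v g y)" for x y
    using gR[of x "g y"] gR[of y "g x"]
    by (simp add: inner_diff_left inner_diff_right inner_commute)
  have sN: "g (A *v x) \<bullet> y = x \<bullet> g (A *v y)" for x y
  proof -
    have "A *v (x - g (A *v x)) = 0" "A *v (y - g (A *v y)) = 0"
      by (simp_all add: matrix_vector_mult_diff_distrib AgA)
    from gN[OF this(1), of "A *v y"] gN[OF this(2), of "A *v x"]
    show ?thesis by (simp add: inner_diff_left inner_diff_right inner_commute)
  qed
  have "penrose_inverse A (matrix g)"
    unfolding penrose_inverse_def
    by (intro conjI symI)
       (simp_all add: matrix_eq matrix_vector_mul_assoc[symmetric] G AgA gAg sR sN)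
  then show ?thesis by blast
qed

lemma penrose_inverse_pinv: "penrose_inverse A (pinv A)"
  unfolding pinv_def using penrose_inverse_exists penrose_inverse_unique by (metis theI)

text \<open>
  \<open>row_proj A\<close> is the matrix P, the orthogonal projection onto the orthogonal complement of the null
  space of \<open>A\<close>; \<open>weight_mat A\<close> is the diagonal matrix W.
\<close>

definition row_proj :: "real ^ 'n ^ 'm \<Rightarrow> real ^ 'n ^ 'n" where
  "row_proj A = pinv A ** A"

definition weight_mat :: "real ^ 'n ^ 'm \<Rightarrow> real ^ 'n ^ 'n" where
  "weight_mat A = (\<chi> i j. if i = j then norm (row_proj A *v axis i 1) else 0)"

definition supp :: "real ^ 'n \<Rightarrow> 'n set" where
  "supp v = {i. v $ i \<noteq> 0}"

definition l1_norm :: "real ^ 'n \<Rightarrow> real" where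
  "l1_norm v = (\<Sum>i\<in>UNIV. \<bar>v $ i\<bar>)"

definition l1_objective :: "real ^ 'n ^ 'm \<Rightarrow> real ^ 'n \<Rightarrow> real \<Rightarrow> real ^ 'n \<Rightarrow> real" where
  "l1_objective A xs \<alpha> x =
     1/2 * (norm (row_proj A *v x - row_proj A *v xs))\<^sup>2 + \<alpha> * l1_norm (weight_mat A *v x)"

end

theory Submission imports Defs
begin

text \<open>
  Write \<open>P\<close> for \<open>row_proj A\<close>, \<open>w\<^sub>i = norm (P e\<^sub>i)\<close> for the weights and \<open>J\<close> for the support of \<open>xs\<close>.
  The hypothesis on \<open>a\<close> provides a dual certificate: with \<open>b = (\<Sum>j\<in>J. a\<^sub>j e\<^sub>j)\<close>, the vector
  \<open>s = W\<^sup>-\<^sup>1 P b\<close> has the signs of \<open>xs\<close> on \<open>J\<close> and modulus below 1 elsewhere.  The condition on \<open>\<alpha>\<close>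
  says that \<open>y = xs - \<alpha> b\<close> has the same signs as \<open>xs\<close>, so \<open>s\<close> is a subgradient of the l1 norm at
  \<open>y\<close>, while the gradient of the quadratic term at \<open>y\<close> is \<open>P (y - xs) = - \<alpha> P b = - \<alpha> W s\<close>.  Thus
  \<open>y\<close> satisfies the first-order optimality condition of a convex problem.

  Because the fidelity term is quadratic, optimality can be read off an exact formula rather than
  an inequality (\<open>objective_gap\<close>): for every \<open>z\<close>, the objective at \<open>z\<close> exceeds the one at \<open>y\<close> by
  \<open>1/2 norm (P (z - y))\<^sup>2 + \<alpha> (\<Sum>i. w\<^sub>i (\<bar>z\<^sub>i\<bar> - s\<^sub>i z\<^sub>i))\<close>, where every summand is nonnegative.  So \<open>y\<close> is a
  minimizer, and \<open>z\<close> is another one exactly if all summands vanish (\<open>minimizer_iff\<close>): \<open>A z = A y\<close>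
  and \<open>\<bar>z\<^sub>i\<bar> = s\<^sub>i z\<^sub>i\<close> for all \<open>i\<close>.  The last condition forces \<open>z\<^sub>i = 0\<close> off \<open>J\<close>, so injectivity of \<open>A\<close> on
  the vectors supported in \<open>J\<close> yields \<open>z = y\<close>.  Conversely, a nonzero null vector \<open>v\<close> of \<open>A\<close>
  supported in \<open>J\<close> can be added to \<open>y\<close> with a small coefficient without making a component of
  \<open>y\<close> on \<open>J\<close> change sign, and this gives a second minimizer.
\<close>

section \<open>The projection and the weights\<close>

lemma transpose_row_proj: "transpose (row_proj A) = row_proj A"
  using penrose_inverse_pinv[of A] by (simp add: penrose_inverse_def row_proj_def)

lemma row_proj_idem: "row_proj A *v (row_proj A *v x) = row_proj A *v x"
  using penrose_inverse_pinv[of A]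
  by (simp add: penrose_inverse_def row_proj_def matrix_vector_mul_assoc matrix_mul_assoc)

lemma row_proj_self_adjoint: "(row_proj A *v x) \<bullet> y = x \<bullet> (row_proj A *v y)"
  by (metis dot_lmul_matrix transpose_matrix_vector transpose_row_proj)

lemma row_proj_eq_0_iff: "row_proj A *v x = 0 \<longleftrightarrow> A *v x = 0"
proof
  assume "row_proj A *v x = 0"
  then have "A *v (row_proj A *v x) = 0" by simp
  then show "A *v x = 0"
    using penrose_inverse_pinv[of A]
    by (simp add: penrose_inverse_def row_proj_def matrix_vector_mul_assoc matrix_mul_assoc)
next
  assume "A *v x = 0"
  then show "row_proj A *v x = 0"
    by (simp add: row_proj_def flip: matrix_vector_mul_assoc)
qed

definition weight :: "real ^ 'n ^ 'm \<Rightarrow> 'n \<Rightarrow> real" where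
  "weight A i = norm (row_proj A *v axis i 1)"

lemma diagonal_matrix_vector_mult_component:
  fixes d :: "'n::finite \<Rightarrow> real"
  shows "((\<chi> i j. if i = j then d i else 0) *v x) $ i = d i * x $ i"
  by (simp add: matrix_vector_mult_def if_distrib[of "\<lambda>c. c * _"] cong: if_cong)

lemma weight_mat_component: "(weight_mat A *v x) $ i = weight A i * x $ i"
  unfolding weight_mat_def weight_def by (rule diagonal_matrix_vector_mult_component)

lemma matrix_inv_weight_mat_component:
  assumes "\<And>i. weight A i > 0"
  shows "(matrix_inv (weight_mat A) *v x) $ i = x $ i / weight A i"
proof -
  let ?D = "(\<chi> i j. if i = j then 1 / weight A i else 0) :: real ^ 'a ^ 'a"
  have D: "(?D *v u) $ i = u $ i / weight A i" for u i
    by (simp add: diagonal_matrix_vector_mult_component)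
  have nz: "weight A i \<noteq> 0" for i using assms[of i] by simp
  have inverse: "weight_mat A ** ?D = mat 1" "?D ** weight_mat A = mat 1"
    by (simp_all add: matrix_eq vec_eq_iff weight_mat_component D nz flip: matrix_vector_mul_assoc)
  have "weight_mat A ** matrix_inv (weight_mat A) = mat 1"
    unfolding matrix_inv_def
    by (rule someI2[where a = ?D]) (rule conjI[OF inverse], rule conjunct1)
  then have "weight_mat A *v (matrix_inv (weight_mat A) *v x) = x"
    by (simp add: matrix_vector_mul_assoc)
  then have "weight A i * (matrix_inv (weight_mat A) *v x) $ i = x $ i"
    by (simp flip: weight_mat_component)
  then show ?thesis using nz[of i] by (simp add: field_simps)
qed

lemma l1_norm_weight_mat: "l1_norm (weight_mat A *v x) = (\<Sum>i\<in>UNIV. weight A i * \<bar>x $ i\<bar>)"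
  by (simp add: l1_norm_def weight_mat_component abs_mult weight_def)

section \<open>Minimizers in the presence of a dual certificate\<close>

text \<open>
  The quadratic term is expanded about \<open>y\<close>.  The cross term is \<open>(P (z - y)) \<bullet> (P (y - xs))\<close>, and
  by optimality of \<open>y\<close> it equals \<open>- \<alpha> (\<Sum>i. w\<^sub>i s\<^sub>i (z\<^sub>i - y\<^sub>i))\<close>; its \<open>y\<close> part cancels the l1 term of \<open>y\<close>.
\<close>

lemma objective_gap:
  assumes opt: "row_proj A *v (y - xs) = - (\<alpha> *\<^sub>R (\<chi> i. weight A i * s $ i))"
    and sy: "\<And>i. s $ i * y $ i = \<bar>y $ i\<bar>"
  shows "l1_objective A xs \<alpha> z = l1_objective A xs \<alpha> y
    + 1/2 * (norm (row_proj A *v (z - y)))\<^sup>2 + \<alpha> * (\<Sum>i\<in>UNIV. weight A i * (\<bar>z $ i\<bar> - s $ i * z $ i))"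
proof -
  let ?P = "row_proj A"
  have "(?P *v (z - y)) \<bullet> (?P *v (y - xs)) = (z - y) \<bullet> (?P *v (y - xs))"
    by (simp add: row_proj_self_adjoint row_proj_idem)
  also have "\<dots> = - \<alpha> * (\<Sum>i\<in>UNIV. weight A i * (s $ i * z $ i - \<bar>y $ i\<bar>))"
    unfolding opt by (simp add: inner_vec_def sum_distrib_left sy[symmetric] algebra_simps
      flip: sum_negf sum_subtractf)
  finally have cross: "(?P *v (z - y)) \<bullet> (?P *v (y - xs))
    = - \<alpha> * (\<Sum>i\<in>UNIV. weight A i * (s $ i * z $ i - \<bar>y $ i\<bar>))" .
  have "(norm (?P *v z - ?P *v xs))\<^sup>2 = (norm (?P *v (z - y) + ?P *v (y - xs)))\<^sup>2"
    by (simp add: matrix_vector_mult_diff_distrib)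
  also have "\<dots> = (norm (?P *v (z - y)))\<^sup>2 + 2 * ((?P *v (z - y)) \<bullet> (?P *v (y - xs)))
      + (norm (?P *v (y - xs)))\<^sup>2"
    by (simp only: power2_norm_eq_inner inner_add_left inner_add_right inner_commute)
  finally have "(norm (?P *v z - ?P *v xs))\<^sup>2 = (norm (?P *v (z - y)))\<^sup>2
      + 2 * ((?P *v (z - y)) \<bullet> (?P *v (y - xs))) + (norm (?P *v y - ?P *v xs))\<^sup>2"
    by (simp only: matrix_vector_mult_diff_distrib)
  then show ?thesis
    unfolding l1_objective_def l1_norm_weight_mat cross
    by (simp add: algebra_simps sum_subtractf sum.distrib)
qed

lemma minimizer_iff:
  assumes opt: "row_proj A *v (y - xs) = - (\<alpha> *\<^sub>R (\<chi> i. weight A i * s $ i))"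
    and sy: "\<And>i. s $ i * y $ i = \<bar>y $ i\<bar>"
    and s_le: "\<And>i. \<bar>s $ i\<bar> \<le> 1"
    and pos: "\<alpha> > 0" "\<And>i. weight A i > 0"
  shows "is_arg_min (l1_objective A xs \<alpha>) (\<lambda>_. True) z \<longleftrightarrow>
    A *v z = A *v y \<and> (\<forall>i. \<bar>z $ i\<bar> = s $ i * z $ i)"
proof -
  let ?F = "l1_objective A xs \<alpha>"
  let ?q = "\<lambda>z. 1/2 * (norm (row_proj A *v (z - y)))\<^sup>2"
  let ?r = "\<lambda>z. \<Sum>i\<in>UNIV. weight A i * (\<bar>z $ i\<bar> - s $ i * z $ i)"
  have gap: "?F z = ?F y + ?q z + \<alpha> * ?r z" for z
    by (rule objective_gap[OF opt sy])
  have le: "s $ i * z $ i \<le> \<bar>z $ i\<bar>" for z i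
  proof -
    have "s $ i * z $ i \<le> \<bar>s $ i\<bar> * \<bar>z $ i\<bar>" by (metis abs_ge_self abs_mult)
    also have "\<dots> \<le> \<bar>z $ i\<bar>" using s_le[of i] by (simp add: mult_left_le_one_le)
    finally show ?thesis .
  qed
  have term_nonneg: "0 \<le> weight A i * (\<bar>z $ i\<bar> - s $ i * z $ i)" for z i
    using le[of i z] pos(2)[of i] by simp
  have r_nonneg: "0 \<le> \<alpha> * ?r z" for z
    using pos(1) by (intro mult_nonneg_nonneg sum_nonneg term_nonneg) simp_all
  have min_y: "?F y \<le> ?F z" for z
    using gap[of z] r_nonneg[of z] by simp
  have "is_arg_min ?F (\<lambda>_. True) z \<longleftrightarrow> ?F z = ?F y"
    unfolding is_arg_min_def using min_y by (metis linorder_not_less order_antisym)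
  also have "\<dots> \<longleftrightarrow> ?q z + \<alpha> * ?r z = 0"
    using gap[of z] by auto
  also have "\<dots> \<longleftrightarrow> ?q z = 0 \<and> \<alpha> * ?r z = 0"
    by (rule add_nonneg_eq_0_iff) (simp_all add: r_nonneg)
  also have "?q z = 0 \<longleftrightarrow> A *v (z - y) = 0"
    by (simp add: row_proj_eq_0_iff)
  also have "\<dots> \<longleftrightarrow> A *v z = A *v y"
    by (simp add: matrix_vector_mult_diff_distrib)
  also have "\<alpha> * ?r z = 0 \<longleftrightarrow> (\<forall>i. \<bar>z $ i\<bar> = s $ i * z $ i)"
  proof -
    have "weight A i \<noteq> 0" for i using pos(2)[of i] by simp
    then show ?thesis using pos(1) by (simp add: sum_nonneg_eq_0_iff term_nonneg)
  qed
  finally show ?thesis .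
qed

text \<open>
  A perturbation of size \<open>\<bar>t v\<^sub>i\<bar> \<le> \<bar>y\<^sub>i\<bar>\<close> keeps \<open>y\<^sub>i + t v\<^sub>i\<close> in the closed half-line of \<open>y\<^sub>i\<close>, which is all
  that minimality needs.
\<close>

lemma sign_preserving_perturbation:
  fixes y v :: "real ^ 'n"
  assumes "v \<noteq> 0" "supp v \<subseteq> supp y"
  obtains t where "t \<noteq> 0" "\<And>i. \<bar>y $ i + t * v $ i\<bar> = sgn (y $ i) * (y $ i + t * v $ i)"
proof -
  define m where "m = Min ((\<lambda>i. \<bar>y $ i\<bar>) ` supp y)"
  have "supp v \<noteq> {}" using \<open>v \<noteq> 0\<close> by (auto simp: supp_def vec_eq_iff)
  then have "supp y \<noteq> {}" using assms(2) by auto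
  then have "m > 0" by (simp add: m_def supp_def)
  have m_le: "m \<le> \<bar>y $ i\<bar>" if "i \<in> supp y" for i
    using that by (simp add: m_def)
  define t where "t = m / norm v"
  have "t > 0" using \<open>m > 0\<close> \<open>v \<noteq> 0\<close> by (simp add: t_def)
  have "\<bar>y $ i + t * v $ i\<bar> = sgn (y $ i) * (y $ i + t * v $ i)" for i
  proof (cases "i \<in> supp y")
    case True
    have "\<bar>t * v $ i\<bar> \<le> t * norm v"
      using \<open>t > 0\<close> by (simp add: abs_mult component_le_norm_cart)
    also have "\<dots> = m" using \<open>v \<noteq> 0\<close> by (simp add: t_def)
    finally have "\<bar>t * v $ i\<bar> \<le> \<bar>y $ i\<bar>" using m_le[OF True] by linarith
    then show ?thesis using True by (auto simp: supp_def sgn_if)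
  next
    case False
    then show ?thesis using assms(2) by (auto simp: supp_def)
  qed
  then show ?thesis using \<open>t > 0\<close> that[of t] by simp
qed

text \<open>
  Off the support of \<open>y\<close> the strict bound \<open>\<bar>s\<^sub>i\<bar> < 1\<close> is what confines all minimizers to vectors
  supported in \<open>supp y\<close>, so that injectivity there becomes decisive.
\<close>

lemma unique_minimizer_iff_inj_on_supp:
  assumes opt: "row_proj A *v (y - xs) = - (\<alpha> *\<^sub>R (\<chi> i. weight A i * s $ i))"
    and s_on: "\<And>i. i \<in> supp y \<Longrightarrow> s $ i = sgn (y $ i)"
    and s_off: "\<And>i. i \<notin> supp y \<Longrightarrow> \<bar>s $ i\<bar> < 1"
    and pos: "\<alpha> > 0" "\<And>i. weight A i > 0"
  shows "is_arg_min (l1_objective A xs \<alpha>) (\<lambda>_. True) y"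
    and "(\<forall>z. is_arg_min (l1_objective A xs \<alpha>) (\<lambda>_. True) z \<longrightarrow> z = y) \<longleftrightarrow>
      inj_on ((*v) A) {v. supp v \<subseteq> supp y}"
proof -
  let ?min = "is_arg_min (l1_objective A xs \<alpha>) (\<lambda>_. True)"
  have sy: "s $ i * y $ i = \<bar>y $ i\<bar>" for i
    by (cases "i \<in> supp y") (simp_all add: s_on supp_def abs_sgn mult.commute)
  have s_le: "\<bar>s $ i\<bar> \<le> 1" for i
    by (cases "i \<in> supp y") (auto simp: s_on sgn_if intro: less_imp_le s_off)
  note min_iff = minimizer_iff[OF opt sy s_le pos]
  show "?min y" by (simp add: min_iff sy)
  show "(\<forall>z. ?min z \<longrightarrow> z = y) \<longleftrightarrow> inj_on ((*v) A) {v. supp v \<subseteq> supp y}"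
  proof
    assume inj: "inj_on ((*v) A) {v. supp v \<subseteq> supp y}"
    show "\<forall>z. ?min z \<longrightarrow> z = y"
    proof (intro allI impI)
      fix z assume "?min z"
      then have Az: "A *v z = A *v y" and z: "\<And>i. \<bar>z $ i\<bar> = s $ i * z $ i"
        by (simp_all add: min_iff)
      have "z $ i = 0" if "i \<notin> supp y" for i
      proof (rule ccontr)
        assume "z $ i \<noteq> 0"
        moreover have "\<bar>z $ i\<bar> = \<bar>s $ i\<bar> * \<bar>z $ i\<bar>" by (metis z abs_abs abs_mult)
        ultimately show False using s_off[OF that] by simp
      qed
      then have "supp z \<subseteq> supp y" by (auto simp: supp_def)
      then show "z = y" using inj_onD[OF inj Az] by simp
    qed
  next
    assume uniq: "\<forall>z. ?min z \<longrightarrow> z = y"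
    have null_trivial: "v = 0" if v: "supp v \<subseteq> supp y" "A *v v = 0" for v
    proof (rule ccontr)
      assume "v \<noteq> 0"
      then obtain t where "t \<noteq> 0"
        and t: "\<And>i. \<bar>y $ i + t * v $ i\<bar> = sgn (y $ i) * (y $ i + t * v $ i)"
        using sign_preserving_perturbation v(1) by blast
      let ?z = "y + t *\<^sub>R v"
      have "A *v ?z = A *v y"
        by (simp add: matrix_vector_right_distrib matrix_vector_mult_scaleR v(2))
      moreover have "\<bar>?z $ i\<bar> = s $ i * ?z $ i" for i
      proof (cases "i \<in> supp y")
        case True
        then show ?thesis using t[of i] by (simp add: s_on)
      next
        case False
        then have "v $ i = 0" "y $ i = 0" using v(1) by (auto simp: supp_def)
        then show ?thesis by simp
      qed
      ultimately have "?min ?z" by (simp add: min_iff)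
      then show False using uniq \<open>t \<noteq> 0\<close> \<open>v \<noteq> 0\<close> by force
    qed
    show "inj_on ((*v) A) {v. supp v \<subseteq> supp y}"
    proof (rule inj_onI)
      fix u v assume uv: "u \<in> {v. supp v \<subseteq> supp y}" "v \<in> {v. supp v \<subseteq> supp y}"
        and "A *v u = A *v v"
      moreover have "supp (u - v) \<subseteq> supp y" using uv by (force simp: supp_def)
      ultimately have "u - v = 0"
        by (intro null_trivial) (simp_all add: matrix_vector_mult_diff_distrib)
      then show "u = v" by simp
    qed
  qed
qed

section \<open>The minimizer with prescribed support and signs\<close>

theorem theorem4p6:
  fixes A :: "real ^ 'n ^ 'm"
    and xs a :: "real ^ 'n"
    and \<alpha> :: real
  assumes "\<exists>v. v \<noteq> 0 \<and> A *v v = 0"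
    and "\<forall>i. row_proj A *v axis i 1 \<noteq> 0"
    and "\<forall>i\<in>supp xs.
           (\<Sum>j\<in>supp xs. a $ j *\<^sub>R (matrix_inv (weight_mat A) *v (row_proj A *v axis j 1))) $ i
             = sgn (xs $ i)"
    and "\<forall>i\<in>- supp xs.
           (\<Sum>j\<in>supp xs. a $ j *\<^sub>R (matrix_inv (weight_mat A) *v (row_proj A *v axis j 1))) $ i
             \<in> {-1<..<1}"
    and "\<alpha> > 0"
    and "\<forall>j\<in>supp xs. sgn (xs $ j - \<alpha> * a $ j) = sgn (xs $ j)"
  shows "let y = (\<Sum>j\<in>supp xs. (xs $ j - \<alpha> * a $ j) *\<^sub>R axis j 1);
             solves = is_arg_min (l1_objective A xs \<alpha>) (\<lambda>_. True)
         in solves y \<and>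
            ((\<forall>z. solves z \<longrightarrow> z = y) \<longleftrightarrow> inj_on ((*v) A) {v. supp v \<subseteq> supp xs})"
proof -
  let ?J = "supp xs" and ?P = "row_proj A"
  define b :: "real ^ 'n" where "b = (\<Sum>j\<in>?J. a $ j *\<^sub>R axis j 1)"
  define y :: "real ^ 'n" where "y = (\<Sum>j\<in>?J. (xs $ j - \<alpha> * a $ j) *\<^sub>R axis j 1)"
  define s where "s = matrix_inv (weight_mat A) *v (?P *v b)"
  have pos: "weight A i > 0" for i
    using assms(2) by (simp add: weight_def)
  have sum_axis: "(\<Sum>j\<in>?J. c j *\<^sub>R (axis j 1 :: real ^ 'n)) $ i = (if i \<in> ?J then c i else 0)"
    for c :: "'n \<Rightarrow> real" and i
    by (simp add: axis_def if_distrib[of "\<lambda>u. _ * u"] cong: if_cong)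
  have y_nth: "y $ i = (if i \<in> ?J then xs $ i - \<alpha> * a $ i else 0)" for i
    unfolding y_def by (rule sum_axis)
  have y_eq: "y - xs = - (\<alpha> *\<^sub>R b)"
    by (simp add: vec_eq_iff y_nth b_def sum_axis del: sum_component) (simp add: supp_def)
  have sgn_y: "sgn (y $ i) = sgn (xs $ i)" for i
    using assms(6) by (simp add: y_nth) (simp add: supp_def)
  have supp_y: "supp y = ?J"
  proof -
    have "y $ i = 0 \<longleftrightarrow> xs $ i = 0" for i using sgn_y[of i] by (metis sgn_eq_0_iff)
    then show ?thesis by (simp add: supp_def)
  qed
  have s_eq: "s = (\<Sum>j\<in>?J. a $ j *\<^sub>R (matrix_inv (weight_mat A) *v (?P *v axis j 1)))"
    unfolding s_def b_def by (simp add: matrix_vector_mult_scaleR vec.linear_sum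
      linear_sum[OF matrix_vector_mul_linear])
  have "?P *v b = (\<chi> i. weight A i * s $ i)"
    using pos by (simp add: vec_eq_iff s_def matrix_inv_weight_mat_component less_imp_neq[symmetric])
  then have opt: "?P *v (y - xs) = - (\<alpha> *\<^sub>R (\<chi> i. weight A i * s $ i))"
    unfolding y_eq by (simp only: matrix_vector_mult_scaleR flip: scaleR_minus_left)
  have s_on: "s $ i = sgn (y $ i)" if "i \<in> supp y" for i
    using assms(3) that unfolding s_eq[symmetric] supp_y by (simp add: sgn_y)
  have s_off: "\<bar>s $ i\<bar> < 1" if "i \<notin> supp y" for i
  proof -
    have "s $ i \<in> {-1<..<1}" using assms(4) that unfolding s_eq[symmetric] supp_y by blast
    then show ?thesis by (simp add: abs_less_iff)
  qed
  have "is_arg_min (l1_objective A xs \<alpha>) (\<lambda>_. True) y"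
    by (rule unique_minimizer_iff_inj_on_supp(1)[OF opt s_on s_off assms(5) pos])
  moreover have "(\<forall>z. is_arg_min (l1_objective A xs \<alpha>) (\<lambda>_. True) z \<longrightarrow> z = y)
      \<longleftrightarrow> inj_on ((*v) A) {v. supp v \<subseteq> ?J}"
    by (rule unique_minimizer_iff_inj_on_supp(2)[OF opt s_on s_off assms(5) pos, unfolded supp_y])
  ultimately show ?thesis
    unfolding Let_def y_def[symmetric] by (rule conjI)
qed

end
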